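(* Let $K$ and $L$ be compact (Hausdorff) spaces. If $L$ contains a subspace homeomorphic to the Cantor space $2^\omega$ and there exists a continuous linear surjection $T\colon\mathcal C_p(K)\to\mathcal C_p(L)$, then $K$ also contains a subspace homeomorphic to $2^\omega$.
   Context: For a compact space $K$, $\mathcal C_p(K)$ denotes the vector space of continuous real-valued functions on $K$ endowed with the topology of pointwise convergence. *)

theory Defs
  imports "HOL-Analysis.Analysis"
begin

definition Cp_carrier :: "'a topology \<Rightarrow> ('a \<Rightarrow> real) set" where
  "Cp_carrier K = {f. continuous_map K euclideanreal f \<and> (\<forall>x. x \<notin> topspace K \<longrightarrow> f x = 0)}"

definition Cp :: "'a topology \<Rightarrow> ('a \<Rightarrow> real) topology" where
  "Cp K = pullback_topology (Cp_carrier K) (\<lambda>f. restrict f (topspace K))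
            (product_topology (\<lambda>_. euclideanreal) (topspace K))"

definition cantor_space :: "(nat \<Rightarrow> bool) topology" where
  "cantor_space = product_topology (\<lambda>_. discrete_topology (UNIV :: bool set)) UNIV"

definition contains_cantor :: "'a topology \<Rightarrow> bool" where
  "contains_cantor X \<longleftrightarrow> (\<exists>S \<subseteq> topspace X. subtopology X S homeomorphic_space cantor_space)"

end

theory Submission
  imports Defs
begin

text \<open>
  For \<open>y\<close> in \<open>L\<close> the functional \<open>f \<mapsto> T f y\<close> is continuous for pointwise convergence, so it only
  depends on the values of \<open>f\<close> on a finite set; let \<open>support y\<close> be a minimal such set. The map
  \<open>support\<close> is lower semicontinuous, and since \<open>T\<close> is onto, the functionals at distinct points are
  linearly independent, so at most \<open>|F|\<close> points have support \<open>F\<close>. Over a Cantor set in \<open>L\<close> the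
  supports therefore cover an uncountable subset of \<open>K\<close>. Near a point \<open>z\<close>, the points of the
  support depend continuously on \<open>y\<close> as long as \<open>y\<close> stays in the closed set where the support has
  no more points than that of \<open>z\<close>. By a Lindeloef argument one of countably many
  such continuous selectors has uncountable image, and a Cantor scheme inside its compact domain
  yields a Cantor set on which it is injective.
\<close>

section \<open>Cylinders and the topology of the Cantor space\<close>

definition cylinder :: "(nat \<Rightarrow> bool) \<Rightarrow> nat \<Rightarrow> (nat \<Rightarrow> bool) set" where
  "cylinder z n = {w. \<forall>i<n. w i = z i}"

lemma mem_cylinder_self [simp]: "z \<in> cylinder z n"
  by (simp add: cylinder_def)

lemma cylinder_mono: "w \<in> cylinder z n \<Longrightarrow> n \<le> m \<Longrightarrow> cylinder w m \<subseteq> cylinder z n"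
  by (force simp: cylinder_def)

text \<open>A cylinder is determined by a finite boolean word, and there are only countably many
  such words.\<close>

lemma countable_cylinders: "countable (range (\<lambda>(z, n). cylinder z n))"
proof (rule countable_subset)
  show "range (\<lambda>(z, n). cylinder z n) \<subseteq>
      range (\<lambda>bs. {w. \<forall>i<length bs. w i = bs ! i})"
  proof clarify
    fix z :: "nat \<Rightarrow> bool" and n
    have "cylinder z n = {w. \<forall>i<length (map z [0..<n]). w i = map z [0..<n] ! i}"
      by (simp add: cylinder_def)
    then show "cylinder z n \<in> range (\<lambda>bs. {w. \<forall>i<length bs. w i = bs ! i})"
      by (rule range_eqI)
  qed
qed simp

lemma topspace_cantor_space [simp]: "topspace cantor_space = UNIV"
  by (simp add: cantor_space_def)

lemma compact_cantor_space: "compact_space cantor_space"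
  by (simp add: cantor_space_def compact_space_product_topology compact_space_discrete_topology)

text \<open>Reduces later questions of openness and continuity on the Cantor space to comparing
  initial segments: a basic box restricts only finitely many coordinates, hence contains a cylinder
  around each of its points.\<close>

lemma openin_cantor_space: "openin cantor_space U \<longleftrightarrow> (\<forall>z\<in>U. \<exists>n. cylinder z n \<subseteq> U)"
proof
  assume U: "openin cantor_space U"
  show "\<forall>z\<in>U. \<exists>n. cylinder z n \<subseteq> U"
  proof
    fix z assume "z \<in> U"
    then obtain X where X: "finite {i. X i \<noteq> (UNIV :: bool set)}" "z \<in> Pi\<^sub>E UNIV X" "Pi\<^sub>E UNIV X \<subseteq> U"
      using U unfolding cantor_space_def openin_product_topology_alt by auto
    obtain n where n: "\<And>i. X i \<noteq> UNIV \<Longrightarrow> i < n"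
      using X(1) finite_nat_set_iff_bounded by auto
    have "cylinder z n \<subseteq> Pi\<^sub>E UNIV X"
      using n X(2) by (fastforce simp: cylinder_def PiE_def Pi_def)
    then show "\<exists>n. cylinder z n \<subseteq> U" using X(3) by blast
  qed
next
  assume R: "\<forall>z\<in>U. \<exists>n. cylinder z n \<subseteq> U"
  have op: "openin cantor_space (cylinder z n)" for z n
  proof -
    have "cylinder z n = Pi\<^sub>E UNIV (\<lambda>i. if i < n then {z i} else UNIV)"
      by (auto simp: cylinder_def PiE_def Pi_def split: if_splits)
    moreover have "finite {i. (if i < n then {z i} else UNIV) \<noteq> (UNIV :: bool set)}"
      by (rule finite_subset[of _ "{..<n}"]) auto
    ultimately show ?thesis
      unfolding cantor_space_def by (simp add: openin_PiE_gen)
  qed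
  show "openin cantor_space U"
    by (subst openin_subopen) (use R op in \<open>meson mem_cylinder_self\<close>)
qed

lemma uncountable_cantor: "uncountable (UNIV :: (nat \<Rightarrow> bool) set)"
proof
  assume "countable (UNIV :: (nat \<Rightarrow> bool) set)"
  then have "range (from_nat_into UNIV) = (UNIV :: (nat \<Rightarrow> bool) set)"
    by (simp add: range_from_nat_into)
  \<comment> \<open>Cantor's diagonal sequence would have an index \<open>n\<close>, but it differs
    from the \<open>n\<close>-th sequence at \<open>n\<close>.\<close>
  then obtain n where "(\<lambda>n. \<not> from_nat_into UNIV n n) = (from_nat_into UNIV n :: nat \<Rightarrow> bool)"
    by (metis UNIV_I rangeE)
  then show False by (metis (mono_tags))
qed

section \<open>Cantor schemes for maps with uncountable image\<close>

lemma uncountable_image_splits: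
  assumes K: "Hausdorff_space K" and fK: "f \<in> P \<rightarrow> topspace K"
    and cont: "\<forall>z\<in>P. \<forall>W. openin K W \<and> f z \<in> W \<longrightarrow> (\<exists>n. f ` (P \<inter> cylinder z n) \<subseteq> W)"
    and big: "uncountable (f ` (P \<inter> cylinder z n))"
  obtains z' m where "\<And>b. n < m b" "\<And>b. z' b \<in> cylinder z n"
    "\<And>b. uncountable (f ` (P \<inter> cylinder (z' b) (m b)))"
    "disjnt (f ` (P \<inter> cylinder (z' True) (m True))) (f ` (P \<inter> cylinder (z' False) (m False)))"
proof -
  \<comment> \<open>Condensation points: the cylinders in \<open>N\<close> are countably many and
    each contributes only countably many values, so discarding them leaves the set \<open>Q\<close>
    with uncountable image. In particular \<open>f\<close> takes two different values on
    \<open>Q\<close>.\<close>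
  define N where "N = {C \<in> range (\<lambda>(w, k). cylinder w k). countable (f ` (P \<inter> C))}"
  define Q where "Q = {w \<in> P \<inter> cylinder z n. \<forall>k. uncountable (f ` (P \<inter> cylinder w k))}"
  have "countable N"
    unfolding N_def using countable_cylinders by simp
  then have "countable (\<Union>C\<in>N. f ` (P \<inter> C))"
    by (auto simp: N_def)
  moreover have "f ` (P \<inter> cylinder z n) \<subseteq> f ` Q \<union> (\<Union>C\<in>N. f ` (P \<inter> C))"
  proof clarify
    fix w assume w: "w \<in> P" "w \<in> cylinder z n" "f w \<notin> (\<Union>C\<in>N. f ` (P \<inter> C))"
    have "uncountable (f ` (P \<inter> cylinder w k))" for k
    proof
      assume "countable (f ` (P \<inter> cylinder w k))"
      then have "cylinder w k \<in> N" unfolding N_def by auto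
      then show False using w by (metis IntI UN_I imageI mem_cylinder_self)
    qed
    then show "f w \<in> f ` Q" using w unfolding Q_def by blast
  qed
  ultimately have "uncountable (f ` Q)"
    using big by (meson countable_Un countable_subset)
  then have *: "\<not> f ` Q \<subseteq> {x}" for x
    by (meson countable_empty countable_insert countable_subset)
  obtain w0 where "w0 \<in> Q"
    using * by blast
  moreover obtain w1 where "w1 \<in> Q" "f w0 \<noteq> f w1"
    using *[of "f w0"] by (metis image_subsetI singleton_iff)
  ultimately have w: "w0 \<in> Q" "w1 \<in> Q" "f w0 \<noteq> f w1"
    by auto
  then have P: "w0 \<in> P" "w1 \<in> P" by (auto simp: Q_def)
  then obtain V0 V1 where V: "openin K V0" "openin K V1" "f w0 \<in> V0" "f w1 \<in> V1" "disjnt V0 V1"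
    using K w(3) funcset_mem[OF fK P(1)] funcset_mem[OF fK P(2)]
    unfolding Hausdorff_space_def by blast
  obtain n0 n1 where n: "f ` (P \<inter> cylinder w0 n0) \<subseteq> V0" "f ` (P \<inter> cylinder w1 n1) \<subseteq> V1"
    using cont P V by meson
  \<comment> \<open>The two cylinders are deep enough for their images to lie in the disjoint sets
    \<open>V0\<close> and \<open>V1\<close>; \<open>Suc n\<close> forces the depth to grow
    strictly.\<close>
  define z' where "z' = (\<lambda>b. if b then w0 else w1)"
  define m where "m = (\<lambda>b. max (Suc n) (if b then n0 else n1))"
  have "f ` (P \<inter> cylinder (z' True) (m True)) \<subseteq> V0" "f ` (P \<inter> cylinder (z' False) (m False)) \<subseteq> V1"
    using n cylinder_mono[of w0 w0 n0 "m True"] cylinder_mono[of w1 w1 n1 "m False"]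
    unfolding z'_def m_def by fastforce+
  then have "disjnt (f ` (P \<inter> cylinder (z' True) (m True))) (f ` (P \<inter> cylinder (z' False) (m False)))"
    using V(5) by (meson disjnt_subset1 disjnt_subset2)
  moreover have "n < m b" "z' b \<in> cylinder z n" "uncountable (f ` (P \<inter> cylinder (z' b) (m b)))" for b
    using w(1,2) by (auto simp: m_def z'_def Q_def)
  ultimately show ?thesis using that by blast
qed

text \<open>Iterating the splitting gives a binary tree of cylinders in which siblings have disjoint
  images. Each branch \<open>x\<close> shrinks to a point \<open>g x\<close>, which lies in
  \<open>P\<close> because \<open>P\<close> is closed, and \<open>f \<circ> g\<close> is a
  continuous injection of a compact space into a Hausdorff space.\<close>

lemma contains_cantor_if_uncountable_image:
  assumes K: "Hausdorff_space K" and fK: "f \<in> P \<rightarrow> topspace K"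
    and cont: "\<forall>z\<in>P. \<forall>W. openin K W \<and> f z \<in> W \<longrightarrow> (\<exists>n. f ` (P \<inter> cylinder z n) \<subseteq> W)"
    and closed: "closedin cantor_space P"
    and uncount: "uncountable (f ` P)"
  shows "contains_cantor K"
proof -
  \<comment> \<open>A pair \<open>c\<close> of a sequence and a depth codes a cylinder, a node of
    the tree; \<open>h c\<close> below gives its two children.\<close>
  define img where "img = (\<lambda>c. f ` (P \<inter> cylinder (fst c) (snd c)))"
  define good where "good = (\<lambda>c. uncountable (img c))"
  have "\<exists>h. \<forall>b. snd c < snd (h b) \<and> fst (h b) \<in> cylinder (fst c) (snd c) \<and> good (h b) \<and>
      disjnt (img (h True)) (img (h False))" if "good c" for c
  proof -
    from that have "uncountable (f ` (P \<inter> cylinder (fst c) (snd c)))"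
      by (simp add: good_def img_def)
    then obtain z' m where "\<And>b. snd c < m b" "\<And>b. z' b \<in> cylinder (fst c) (snd c)"
      "\<And>b. uncountable (f ` (P \<inter> cylinder (z' b) (m b)))"
      "disjnt (f ` (P \<inter> cylinder (z' True) (m True))) (f ` (P \<inter> cylinder (z' False) (m False)))"
      by (rule uncountable_image_splits[OF K fK cont]) (rule that)
    then show ?thesis
      by (intro exI[of _ "\<lambda>b. (z' b, m b)"]) (auto simp: good_def img_def)
  qed
  then obtain h where h: "\<And>c b. good c \<Longrightarrow> snd c < snd (h c b)"
    "\<And>c b. good c \<Longrightarrow> fst (h c b) \<in> cylinder (fst c) (snd c)"
    "\<And>c b. good c \<Longrightarrow> good (h c b)"
    "\<And>c. good c \<Longrightarrow> disjnt (img (h c True)) (img (h c False))"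
    by metis
  \<comment> \<open>The node reached along \<open>x\<close> after \<open>k\<close> steps. The root
    has depth 0, so its cylinder is the whole space and the sequence stored there is
    irrelevant.\<close>
  define st where "st = (\<lambda>x. rec_nat (\<lambda>_. False, 0) (\<lambda>k c. h c (x k)))"
  have st0: "st x 0 = (\<lambda>_. False, 0)" and stS: "st x (Suc k) = h (st x k) (x k)" for x k
    by (simp_all add: st_def)
  have good_st: "good (st x k)" for x k
  proof (induction k)
    case 0
    have "P \<inter> cylinder (\<lambda>_. False) 0 = P" by (auto simp: cylinder_def)
    then show ?case using uncount by (simp add: st0 good_def img_def)
  qed (simp add: stS h)
  have depth: "k \<le> snd (st x k)" for x k
  proof (induction k)
    case (Suc k)
    then show ?case using h(1)[OF good_st, of x k "x k"] by (simp add: stS)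
  qed simp
  define cyl where "cyl = (\<lambda>x k. cylinder (fst (st x k)) (snd (st x k)))"
  have cyl_Suc: "cyl x (Suc k) \<subseteq> cyl x k" for x k
    unfolding cyl_def stS
    using h(1,2)[OF good_st, of x k] by (intro cylinder_mono) (auto simp: less_imp_le)
  have cyl_anti: "cyl x (k + j) \<subseteq> cyl x k" for x k j
    by (induction j) (use cyl_Suc in auto)
  have st_cong: "st x k = st y k" if "y \<in> cylinder x k" for x y k
    using that by (induction k) (auto simp: st0 stS cylinder_def)
  \<comment> \<open>By \<open>depth\<close>, the node at level \<open>Suc i\<close> has depth
    greater than \<open>i\<close>, so nestedness makes its \<open>i\<close>-th coordinate final
    along the branch.\<close>
  define g where "g = (\<lambda>x i. fst (st x (Suc i)) i)"
  have g_cyl: "g x \<in> cyl x k" for x k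
  proof -
    have "g x i = fst (st x k) i" if "i < snd (st x k)" for i
    proof (cases "Suc i \<le> k")
      case True
      then have "fst (st x k) \<in> cyl x (Suc i)"
        using cyl_anti[of x "Suc i" "k - Suc i"] by (auto simp: cyl_def)
      then show ?thesis
        using depth[of "Suc i" x] by (simp add: cyl_def cylinder_def g_def)
    next
      case False
      then have "fst (st x (Suc i)) \<in> cyl x k"
        using cyl_anti[of x k "Suc i - k"] by (auto simp: cyl_def)
      then show ?thesis
        using that by (simp add: cyl_def cylinder_def g_def)
    qed
    then show ?thesis by (simp add: cyl_def cylinder_def)
  qed
  have g_P: "g x \<in> P" for x
  proof (rule ccontr)
    assume "g x \<notin> P"
    then obtain n where n: "cylinder (g x) n \<subseteq> - P"
      using closed unfolding closedin_def openin_cantor_space by (auto simp: Compl_eq_Diff_UNIV)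
    \<comment> \<open>The node \<open>cyl x n\<close> meets \<open>P\<close>, contains
      \<open>g x\<close> and has depth at least \<open>n\<close>, so it lies inside the cylinder
      that was supposed to miss \<open>P\<close>.\<close>
    have "P \<inter> cyl x n \<noteq> {}"
      using good_st[of x n] by (auto simp: good_def img_def cyl_def)
    then obtain w where w: "w \<in> P" "w \<in> cyl x n" by blast
    then have "w \<in> cylinder (g x) n"
      using g_cyl[of x n] depth[of n x] by (simp add: cyl_def cylinder_def)
    then show False using n w by blast
  qed
  have "inj (f \<circ> g)"
  proof (rule injI, rule ccontr)
    fix x y assume eq: "(f \<circ> g) x = (f \<circ> g) y" and "x \<noteq> y"
    then have "\<exists>k. x k \<noteq> y k" by blast
    \<comment> \<open>At the first difference \<open>k\<close> both branches are still at the same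
      node and then move to opposite children, whose images are disjoint.\<close>
    then obtain k where k: "x k \<noteq> y k" "\<And>i. i < k \<Longrightarrow> x i = y i"
      using exists_least_iff[of "\<lambda>k. x k \<noteq> y k"] by blast
    then have "st x k = st y k" by (intro st_cong) (simp add: cylinder_def)
    then have "disjnt (img (st x (Suc k))) (img (st y (Suc k)))"
      using h(4)[OF good_st, of x k] k(1) unfolding stS
      by (cases "x k"; cases "y k") (auto simp: disjnt_sym)
    moreover have "f (g w) \<in> img (st w (Suc k))" for w
      using g_P[of w] g_cyl[of w "Suc k"] by (simp add: img_def cyl_def)
    ultimately show False using eq by (metis comp_apply disjnt_iff)
  qed
  moreover have "continuous_map cantor_space K (f \<circ> g)"
    unfolding continuous_map_def
  proof (intro conjI allI impI)
    show "f \<circ> g \<in> topspace cantor_space \<rightarrow> topspace K"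
      using g_P fK by auto
    fix W assume W: "openin K W"
    show "openin cantor_space {x \<in> topspace cantor_space. (f \<circ> g) x \<in> W}"
      unfolding openin_cantor_space
    proof clarsimp
      fix x assume "f (g x) \<in> W"
      then obtain n where n: "f ` (P \<inter> cylinder (g x) n) \<subseteq> W"
        using cont g_P W by meson
      \<comment> \<open>The first \<open>n\<close> coordinates of \<open>g x\<close> depend only on
        the first \<open>n\<close> entries of \<open>x\<close>, which is continuity of
        \<open>g\<close>.\<close>
      have "g y \<in> cylinder (g x) n" if "y \<in> cylinder x n" for y
      proof -
        have "g y i = g x i" if "i < n" for i
          using st_cong[of y x "Suc i"] that \<open>y \<in> cylinder x n\<close>
          by (simp add: cylinder_def g_def)
        then show ?thesis by (simp add: cylinder_def)
      qed
      then show "\<exists>n. cylinder x n \<subseteq> {x. f (g x) \<in> W}"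
        using n g_P by blast
    qed
  qed
  ultimately have "embedding_map cantor_space K (f \<circ> g)"
    using K compact_cantor_space by (intro continuous_imp_embedding_map) auto
  then have "subtopology K (range (f \<circ> g)) homeomorphic_space cantor_space"
    using embedding_map_imp_homeomorphic_space homeomorphic_space_sym by fastforce
  moreover have "range (f \<circ> g) \<subseteq> topspace K"
    using g_P fK by auto
  ultimately show ?thesis
    unfolding contains_cantor_def by blast
qed

section \<open>Lower semicontinuous finite-valued maps and their selectors\<close>

lemma Hausdorff_space_separate_finite:
  assumes X: "Hausdorff_space X" and S: "finite S" "S \<subseteq> topspace X"
  obtains U where "\<And>x. x \<in> S \<Longrightarrow> openin X (U x)" "\<And>x. x \<in> S \<Longrightarrow> x \<in> U x"
    "\<And>x y. \<lbrakk>x \<in> S; y \<in> S; x \<noteq> y\<rbrakk> \<Longrightarrow> disjnt (U x) (U y)"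
proof -
  have "\<exists>V W. openin X V \<and> openin X W \<and> x \<in> V \<and> y \<in> W \<and> disjnt V W"
    if "x \<in> S" "y \<in> S" "x \<noteq> y" for x y
    using X that S(2) unfolding Hausdorff_space_def by blast
  then obtain V W where VW: "\<And>x y. \<lbrakk>x \<in> S; y \<in> S; x \<noteq> y\<rbrakk> \<Longrightarrow>
      openin X (V x y) \<and> openin X (W x y) \<and> x \<in> V x y \<and> y \<in> W x y \<and> disjnt (V x y) (W x y)"
    by metis
  \<comment> \<open>Each pair is separated once in either order, so \<open>x\<close> uses the
    neighbourhoods from pairs where it comes first and from those where it comes second.
    Intersecting with \<open>topspace X\<close> covers the case of a singleton \<open>S\<close>,
    where the inner intersection is \<open>UNIV\<close>.\<close>
  define U where "U = (\<lambda>x. topspace X \<inter> (\<Inter>y\<in>S - {x}. V x y \<inter> W y x))"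
  show ?thesis
  proof
    fix x assume x: "x \<in> S"
    have "openin X (\<Inter>(insert (topspace X) ((\<lambda>y. V x y \<inter> W y x) ` (S - {x}))))"
      by (intro openin_Inter) (use VW x S in auto)
    moreover have "U x = \<Inter>(insert (topspace X) ((\<lambda>y. V x y \<inter> W y x) ` (S - {x})))"
      by (simp add: U_def)
    ultimately show "openin X (U x)" by simp
    show "x \<in> U x" using VW x S by (auto simp: U_def)
    fix y assume y: "y \<in> S" "x \<noteq> y"
    have "U x \<subseteq> V x y" "U y \<subseteq> W x y" using x y by (auto simp: U_def)
    then show "disjnt (U x) (U y)" using VW[OF x y] by (meson disjnt_subset1 disjnt_subset2)
  qed
qed

text \<open>Pigeonhole: disjointness makes \<open>p\<close> injective on \<open>A\<close>. If
  \<open>B\<close> has no more elements than \<open>A\<close>, then \<open>p\<close> exhausts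
  \<open>B\<close>, so \<open>B\<close> has exactly one point in each \<open>U x\<close>.\<close>

lemma choice_from_disjoint:
  assumes fin: "finite B" and disj: "\<And>x y. \<lbrakk>x \<in> A; y \<in> A; x \<noteq> y\<rbrakk> \<Longrightarrow> disjnt (U x) (U y)"
    and p: "\<And>x. x \<in> A \<Longrightarrow> p x \<in> B \<inter> U x"
  shows "card A \<le> card B"
    and "card B \<le> card A \<Longrightarrow> B = p ` A"
    and "\<lbrakk>card B \<le> card A; x \<in> A; u \<in> B \<inter> U x\<rbrakk> \<Longrightarrow> u = p x"
proof -
  have inj: "inj_on p A"
  proof (rule inj_onI, rule ccontr)
    fix x y assume "x \<in> A" "y \<in> A" "p x = p y" "x \<noteq> y"
    then show False using disj[of x y] p[of x] p[of y] by (auto simp: disjnt_iff)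
  qed
  have sub: "p ` A \<subseteq> B" using p by blast
  show "card A \<le> card B" using inj sub fin by (metis card_image card_mono)
  show eq: "B = p ` A" if "card B \<le> card A"
    using inj sub fin that by (metis card_image card_seteq)
  assume *: "card B \<le> card A" "x \<in> A" "u \<in> B \<inter> U x"
  then obtain y where y: "y \<in> A" "u = p y" using eq by blast
  then show "u = p x" using * disj[of x y] p[of y] by (auto simp: disjnt_iff)
qed

text \<open>The topological core, free of operators; \<open>s z\<close> will be the support attached
  to the point of \<open>L\<close> that corresponds to \<open>z\<close>. Countable fibres ensure
  that the values of \<open>s\<close> cannot all lie in one countable set.\<close>

lemma contains_cantor_if_lower_semicontinuous:
  fixes s :: "(nat \<Rightarrow> bool) \<Rightarrow> 'a set"
  assumes K: "Hausdorff_space K"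
    and fin: "\<And>z. finite (s z)" and sub: "\<And>z. s z \<subseteq> topspace K"
    and lsc: "\<And>U. openin K U \<Longrightarrow> openin cantor_space {z. s z \<inter> U \<noteq> {}}"
    and fib: "\<And>F. countable {z. s z = F}"
  shows "contains_cantor K"
proof -
  have "uncountable (\<Union>z. s z)"
  proof
    assume "countable (\<Union>z. s z)"
    \<comment> \<open>A countable set has only countably many finite subsets, and each is the value
      of \<open>s\<close> at only countably many sequences.\<close>
    then have "countable (\<Union>F\<in>{F. finite F \<and> F \<subseteq> (\<Union>z. s z)}. {z. s z = F})"
      using countable_Collect_finite_subset fib by blast
    moreover have "(\<Union>F\<in>{F. finite F \<and> F \<subseteq> (\<Union>z. s z)}. {z. s z = F}) = UNIV"
      using fin by auto
    ultimately show False using uncountable_cantor by simp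
  qed
  moreover have "(\<Union>z. s z) = (\<Union>n. \<Union>z\<in>{z. card (s z) = n}. s z)" by auto
  ultimately have big: "uncountable (\<Union>n. \<Union>z\<in>{z. card (s z) = n}. s z)"
    by simp
  have "\<exists>n. uncountable (\<Union>z\<in>{z. card (s z) = n}. s z)"
  proof (rule ccontr)
    assume "\<nexists>n. uncountable (\<Union>z\<in>{z. card (s z) = n}. s z)"
    then have "countable (\<Union>z\<in>{z. card (s z) = n}. s z)" for n
      by blast
    then show False
      using big countable_UN[OF countableI_type] by meson
  qed
  then obtain n where n: "uncountable (\<Union>z\<in>{z. card (s z) = n}. s z)"
    by blast
  define sep where "sep = (\<lambda>z m U. (\<forall>x\<in>s z. openin K (U x)) \<and>
      (\<forall>x\<in>s z. \<forall>y\<in>s z. x \<noteq> y \<longrightarrow> disjnt (U x) (U y)) \<and>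
      (\<forall>w\<in>cylinder z m. \<forall>x\<in>s z. s w \<inter> U x \<noteq> {}))"
  have "\<exists>m U. sep z m U" for z
  proof -
    obtain U where U: "\<And>x. x \<in> s z \<Longrightarrow> openin K (U x)" "\<And>x. x \<in> s z \<Longrightarrow> x \<in> U x"
      "\<And>x y. \<lbrakk>x \<in> s z; y \<in> s z; x \<noteq> y\<rbrakk> \<Longrightarrow> disjnt (U x) (U y)"
      using Hausdorff_space_separate_finite[OF K fin sub] by metis
    have "\<exists>m. cylinder z m \<subseteq> {w. s w \<inter> U x \<noteq> {}}" if "x \<in> s z" for x
      using lsc[OF U(1)[OF that]] U(2)[OF that] that unfolding openin_cantor_space by blast
    then obtain k where k: "\<And>x. x \<in> s z \<Longrightarrow> cylinder z (k x) \<subseteq> {w. s w \<inter> U x \<noteq> {}}"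
      by metis
    \<comment> \<open>The largest of finitely many depths serves all points at once. If
      \<open>s z\<close> is empty, the value of \<open>Max\<close> does not matter, since there is
      no \<open>x\<close> to check.\<close>
    have "\<forall>w\<in>cylinder z (Max (k ` s z)). \<forall>x\<in>s z. s w \<inter> U x \<noteq> {}"
    proof (intro ballI)
      fix w x assume *: "w \<in> cylinder z (Max (k ` s z))" "x \<in> s z"
      then have "k x \<le> Max (k ` s z)" using fin by simp
      then have "w \<in> cylinder z (k x)" using * by (simp add: cylinder_def)
      then show "s w \<inter> U x \<noteq> {}" using k[OF *(2)] by blast
    qed
    then have "sep z (Max (k ` s z)) U" using U(1,3) by (simp add: sep_def)
    then show ?thesis by blast
  qed
  then obtain m U where "\<And>z. sep z (m z) (U z)"
    by metis
  then have U: "\<And>z x. x \<in> s z \<Longrightarrow> openin K (U z x)"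
    "\<And>z x y. \<lbrakk>x \<in> s z; y \<in> s z; x \<noteq> y\<rbrakk> \<Longrightarrow> disjnt (U z x) (U z y)"
    and meets: "\<And>z w x. \<lbrakk>w \<in> cylinder z (m z); x \<in> s z\<rbrakk> \<Longrightarrow> s w \<inter> U z x \<noteq> {}"
    by (auto simp: sep_def)
  \<comment> \<open>The selector \<open>f z x\<close> follows the point \<open>x\<close> of
    \<open>s z\<close> as \<open>w\<close> varies near \<open>z\<close>.\<close>
  define f where "f = (\<lambda>z x w. SOME u. u \<in> s w \<inter> U z x)"
  have f: "f z x w \<in> s w \<inter> U z x" if "w \<in> cylinder z (m z)" "x \<in> s z" for z x w
    unfolding f_def some_in_eq by (rule meets[OF that])
  note choice = choice_from_disjoint[where U = "U z" and A = "s z" and p = "\<lambda>x. f z x w" and B = "s w"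
      for z w, OF fin U(2) f]
  \<comment> \<open>Where the cardinality does not exceed that of \<open>s z\<close>, the set
    \<open>s w\<close> has exactly one point in each \<open>U z x\<close>, so the choice made by
    \<open>SOME\<close> is forced.\<close>
  define P where "P = (\<lambda>z. cylinder z (m z) \<inter> {w. card (s w) \<le> card (s z)})"
  \<comment> \<open>The Lindeloef argument: the chosen cylinders form a countable family even if
    their centres do not, so countably many centres \<open>R\<close> already produce all of
    them.\<close>
  have "countable ((\<lambda>z. cylinder z (m z)) ` {z. card (s z) = n})"
    by (rule countable_subset[OF _ countable_cylinders]) auto
  then obtain R where R: "countable R" "R \<subseteq> {z. card (s z) = n}"
    "(\<lambda>z. cylinder z (m z)) ` {z. card (s z) = n} = (\<lambda>z. cylinder z (m z)) ` R"
    unfolding countable_image_eq_inj by blast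
  have "(\<Union>z\<in>{z. card (s z) = n}. s z) \<subseteq> (\<Union>z\<in>R. \<Union>x\<in>s z. f z x ` P z)"
  proof clarify
    fix w u assume w: "n = card (s w)" "u \<in> s w"
    then have "cylinder w (m w) \<in> (\<lambda>z. cylinder z (m z)) ` R"
      unfolding R(3)[symmetric] by blast
    then obtain z where z: "z \<in> R" "cylinder w (m w) = cylinder z (m z)"
      by blast
    then have wz: "w \<in> cylinder z (m z)" "w \<in> P z"
      using mem_cylinder_self[of w "m w"] R(2) w(1) by (auto simp: P_def)
    then have "s w = (\<lambda>x. f z x w) ` s z"
      using choice(2)[of z w] by (simp add: P_def)
    then show "u \<in> (\<Union>z\<in>R. \<Union>x\<in>s z. f z x ` P z)"
      using w(2) z(1) wz(2) by auto
  qed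
  then have un: "uncountable (\<Union>z\<in>R. \<Union>x\<in>s z. f z x ` P z)"
    using n by (meson countable_subset)
  have "\<exists>z. \<exists>x\<in>s z. uncountable (f z x ` P z)"
  proof (rule ccontr)
    assume "\<nexists>z. \<exists>x\<in>s z. uncountable (f z x ` P z)"
    then have "countable (\<Union>x\<in>s z. f z x ` P z)" for z
      by (intro countable_UN countable_finite[OF fin]) blast
    then show False
      using un countable_UN[OF R(1)] by meson
  qed
  then obtain z x where zx: "x \<in> s z" "uncountable (f z x ` P z)"
    by blast
  show ?thesis
  proof (rule contains_cantor_if_uncountable_image[OF K _ _ _ zx(2)])
    show "f z x \<in> P z \<rightarrow> topspace K"
      using f zx(1) sub by (fastforce simp: P_def)
    show "\<forall>w\<in>P z. \<forall>W. openin K W \<and> f z x w \<in> W \<longrightarrow> (\<exists>k. f z x ` (P z \<inter> cylinder w k) \<subseteq> W)"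
    proof (intro ballI allI impI)
      fix w W assume w: "w \<in> P z" "openin K W \<and> f z x w \<in> W"
      \<comment> \<open>Intersecting with \<open>U z x\<close> ensures that a nearby
        \<open>s w'\<close> meets \<open>W\<close> in its unique point in \<open>U z x\<close>, that
        is, in the selected one.\<close>
      then have "openin K (W \<inter> U z x)" "s w \<inter> (W \<inter> U z x) \<noteq> {}"
        using U(1)[OF zx(1)] f[of w z x] zx(1) by (auto simp: P_def)
      then obtain k where k: "cylinder w k \<subseteq> {w'. s w' \<inter> (W \<inter> U z x) \<noteq> {}}"
        using lsc unfolding openin_cantor_space by blast
      have "f z x w' \<in> W" if w': "w' \<in> P z" "w' \<in> cylinder w k" for w'
      proof -
        obtain u where u: "u \<in> s w'" "u \<in> W" "u \<in> U z x" using k w'(2) by blast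
        then have "u = f z x w'"
          using choice(3)[of z w' x u] zx(1) w'(1) by (simp add: P_def)
        then show ?thesis using u by simp
      qed
      then show "\<exists>k. f z x ` (P z \<inter> cylinder w k) \<subseteq> W" by blast
    qed
    have "openin cantor_space (- P z)"
      unfolding openin_cantor_space
    proof
      fix w assume "w \<in> - P z"
      then consider "w \<notin> cylinder z (m z)" | "card (s z) < card (s w)"
        by (force simp: P_def)
      then show "\<exists>k. cylinder w k \<subseteq> - P z"
      proof cases
        case 1
        then have "cylinder w (m z) \<subseteq> - P z" by (auto simp: P_def cylinder_def)
        then show ?thesis by blast
      next
        case 2
        \<comment> \<open>Near \<open>w\<close> the cardinality is at least
          \<open>card (s w)\<close>, by the pigeonhole bound.\<close>
        then have "cylinder w (m w) \<subseteq> - P z" using choice(1)[of w] by (fastforce simp: P_def)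
        then show ?thesis by blast
      qed
    qed
    then show "closedin cantor_space (P z)"
      by (simp add: closedin_def Compl_eq_Diff_UNIV)
  qed
qed

section \<open>Linear relations and spaces of continuous functions\<close>

lemma exists_nontrivial_relation:
  fixes v :: "'j \<Rightarrow> 'x \<Rightarrow> 'k::field"
  assumes "finite F" "finite J" "card F < card J"
  shows "\<exists>c. (\<exists>j\<in>J. c j \<noteq> 0) \<and> (\<forall>x\<in>F. (\<Sum>j\<in>J. c j * v j x) = 0)"
  using assms
proof (induction F arbitrary: J v rule: finite_induct)
  case empty
  then have "J \<noteq> {}" by auto
  then show ?case by (intro exI[of _ "\<lambda>_. 1"]) auto
next
  case (insert a F)
  show ?case
  proof (cases "\<forall>j\<in>J. v j a = 0")
    case True
    then show ?thesis using insert.IH[of J v] insert.hyps insert.prems by auto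
  next
    case False
    then obtain j0 where j0: "j0 \<in> J" "v j0 a \<noteq> 0" by blast
    define J' where "J' = J - {j0}"
    have J: "J = insert j0 J'" "j0 \<notin> J'" "finite J'"
      using j0 insert.prems by (auto simp: J'_def)
    \<comment> \<open>Gaussian elimination with pivot \<open>v j0\<close>: subtracting
      \<open>r j\<close> times the pivot makes every other vector vanish at \<open>a\<close>. A
      relation among the reduced vectors on \<open>F\<close> then lifts, the coefficient of
      \<open>j0\<close> collecting the subtracted multiples.\<close>
    define r where "r = (\<lambda>j. v j a / v j0 a)"
    have "card F < card J'" using insert J by simp
    then obtain c where c: "\<exists>j\<in>J'. c j \<noteq> 0"
      "\<forall>x\<in>F. (\<Sum>j\<in>J'. c j * (v j x - r j * v j0 x)) = 0"
      using insert.IH[OF J(3), of "\<lambda>j x. v j x - r j * v j0 x"] by blast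
    define d where "d = c(j0 := - (\<Sum>j\<in>J'. c j * r j))"
    have d: "(\<Sum>j\<in>J. d j * v j x) = (\<Sum>j\<in>J'. c j * (v j x - r j * v j0 x))" for x
    proof -
      have *: "(\<Sum>j\<in>J'. d j * v j x) = (\<Sum>j\<in>J'. c j * v j x)"
        using J(2) by (intro sum.cong) (auto simp: d_def)
      have "(\<Sum>j\<in>J. d j * v j x) = d j0 * v j0 x + (\<Sum>j\<in>J'. d j * v j x)"
        using J by simp
      also have "\<dots> = (\<Sum>j\<in>J'. c j * (v j x - r j * v j0 x))"
        unfolding * by (simp add: d_def sum_distrib_right sum_subtractf right_diff_distrib mult.assoc)
      finally show ?thesis .
    qed
    have "(\<Sum>j\<in>J. d j * v j x) = 0" if "x \<in> insert a F" for x
      using that c(2) j0(2) unfolding d by (auto simp: r_def)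
    moreover have "\<exists>j\<in>J. d j \<noteq> 0"
      using c(1) J by (auto simp: d_def)
    ultimately show ?thesis by blast
  qed
qed

lemma topspace_Cp [simp]: "topspace (Cp K) = Cp_carrier K"
  by (auto simp: Cp_def topspace_pullback_topology)

lemma continuous_map_Cp_eval:
  assumes "x \<in> topspace K"
  shows "continuous_map (Cp K) euclideanreal (\<lambda>f. f x)"
proof -
  have "continuous_map (Cp K) euclideanreal ((\<lambda>u. u x) \<circ> (\<lambda>f. restrict f (topspace K)))"
    unfolding Cp_def using assms
    by (intro continuous_map_pullback continuous_map_product_projection)
  then show ?thesis using assms by (simp add: o_def)
qed

text \<open>A basic neighbourhood of zero constrains finitely many coordinates only, and a function
  vanishing there satisfies all the constraints.\<close>

lemma Cp_nbhd_zero: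
  assumes "openin (Cp K) S" "(\<lambda>_. 0) \<in> S"
  obtains F where "finite F" "F \<subseteq> topspace K"
    "\<And>f. \<lbrakk>f \<in> Cp_carrier K; \<And>x. x \<in> F \<Longrightarrow> f x = 0\<rbrakk> \<Longrightarrow> f \<in> S"
proof -
  obtain V where V: "openin (product_topology (\<lambda>_. euclideanreal) (topspace K)) V"
    "S = (\<lambda>f. restrict f (topspace K)) -` V \<inter> Cp_carrier K"
    using assms(1) unfolding Cp_def openin_pullback_topology by blast
  then have "restrict (\<lambda>_. 0) (topspace K) \<in> V" using assms(2) by auto
  then obtain X where X: "finite {x \<in> topspace K. X x \<noteq> (UNIV :: real set)}"
    "restrict (\<lambda>_. 0) (topspace K) \<in> Pi\<^sub>E (topspace K) X" "Pi\<^sub>E (topspace K) X \<subseteq> V"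
    using V(1) unfolding openin_product_topology_alt by auto
  show ?thesis
  proof
    show "finite {x \<in> topspace K. X x \<noteq> UNIV}" by fact
    fix f assume f: "f \<in> Cp_carrier K" "\<And>x. x \<in> {x \<in> topspace K. X x \<noteq> UNIV} \<Longrightarrow> f x = 0"
    have "f x \<in> X x" if "x \<in> topspace K" for x
    proof (cases "X x = UNIV")
      case False
      then show ?thesis using f(2)[of x] X(2) that by (auto simp: PiE_iff)
    qed simp
    then have "restrict f (topspace K) \<in> Pi\<^sub>E (topspace K) X" by auto
    then show "f \<in> S" using V(2) X(3) f(1) by blast
  qed auto
qed

lemma Cp_lincomb:
  "\<lbrakk>f \<in> Cp_carrier K; g \<in> Cp_carrier K\<rbrakk> \<Longrightarrow> (\<lambda>x. a * f x + b * g x) \<in> Cp_carrier K"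
  by (auto simp: Cp_carrier_def intro!: continuous_intros)

lemma Cp_mult:
  "\<lbrakk>f \<in> Cp_carrier K; g \<in> Cp_carrier K\<rbrakk> \<Longrightarrow> (\<lambda>x. f x * g x) \<in> Cp_carrier K"
  by (auto simp: Cp_carrier_def intro!: continuous_intros)

lemma Cp_zero: "(\<lambda>_. 0) \<in> Cp_carrier K"
  by (auto simp: Cp_carrier_def)

lemma Cp_bump:
  assumes "compact_space K" "Hausdorff_space K" "openin K U" "x \<in> U"
  obtains h where "h \<in> Cp_carrier K" "h x = 1" "\<And>z. z \<notin> U \<Longrightarrow> h z = 0"
proof -
  have "completely_regular_space K"
    using assms(1,2) by (simp add: compact_imp_locally_compact_space
        locally_compact_regular_imp_completely_regular_space)
  moreover have "closedin K (topspace K - U)" "x \<in> topspace K - (topspace K - U)"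
    using assms(3,4) openin_subset by fastforce+
  ultimately obtain f :: "_ \<Rightarrow> real" where f: "continuous_map K (top_of_set {0..1}) f" "f x = 0"
    "f ` (topspace K - U) \<subseteq> {1}"
    unfolding completely_regular_space_def by meson
  have U: "U \<subseteq> topspace K" using assms(3) openin_subset by blast
  have cont: "continuous_map K euclideanreal (\<lambda>z. 1 - f z)"
    using f(1) by (auto intro!: continuous_intros simp: continuous_map_in_subtopology)
  \<comment> \<open>Elements of \<open>Cp_carrier K\<close> must vanish off
    \<open>topspace K\<close>, where \<open>f\<close> is arbitrary.\<close>
  define h where "h = (\<lambda>z. if z \<in> topspace K then 1 - f z else 0)"
  have "continuous_map K euclideanreal h"
    using cont by (rule continuous_map_eq) (simp add: h_def)
  then show ?thesis
    using that[of h] f(2,3) assms(4) U by (auto simp: h_def Cp_carrier_def image_subset_iff)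
qed

section \<open>Supports of the functionals induced by the operator\<close>

locale Cp_operator =
  fixes K :: "'a topology" and L :: "'b topology" and T :: "('a \<Rightarrow> real) \<Rightarrow> ('b \<Rightarrow> real)"
  assumes compact: "compact_space K" and Hausdorff: "Hausdorff_space K"
    and cont: "continuous_map (Cp K) (Cp L) T"
    and lin: "\<forall>f\<in>Cp_carrier K. \<forall>g\<in>Cp_carrier K. \<forall>a b :: real.
           T (\<lambda>x. a * f x + b * g x) = (\<lambda>y. a * T f y + b * T g y)"
begin

lemma T_scale: "f \<in> Cp_carrier K \<Longrightarrow> T (\<lambda>x. a * f x) = (\<lambda>y. a * T f y)"
  using lin[rule_format, of f f a 0] by simp

lemma T_zero: "T (\<lambda>_. 0) = (\<lambda>_. 0)"
  using T_scale[OF Cp_zero, of 0] by simp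

lemma T_sum:
  assumes "finite J" "\<And>j. j \<in> J \<Longrightarrow> f j \<in> Cp_carrier K"
  shows "(\<lambda>x. \<Sum>j\<in>J. c j * f j x) \<in> Cp_carrier K \<and>
    T (\<lambda>x. \<Sum>j\<in>J. c j * f j x) = (\<lambda>y. \<Sum>j\<in>J. c j * T (f j) y)"
  using assms
proof (induction J rule: finite_induct)
  case empty
  then show ?case by (simp add: Cp_zero T_zero)
next
  case (insert j J)
  then show ?case
    using lin[rule_format, of "f j" "\<lambda>x. \<Sum>j\<in>J. c j * f j x" "c j" 1]
      Cp_lincomb[of "f j" K "\<lambda>x. \<Sum>j\<in>J. c j * f j x" "c j" 1]
    by simp
qed

lemma continuous_map_T_eval: "y \<in> topspace L \<Longrightarrow> continuous_map (Cp K) euclideanreal (\<lambda>f. T f y)"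
  using continuous_map_compose[OF cont continuous_map_Cp_eval] by (simp add: o_def)

lemma continuous_map_T: "f \<in> Cp_carrier K \<Longrightarrow> continuous_map L euclideanreal (T f)"
  using continuous_map_image_subset_topspace[OF cont] by (auto simp: Cp_carrier_def)

text \<open>By linearity this says that \<open>T f y\<close> depends only on the restriction of
  \<open>f\<close> to \<open>F\<close>.\<close>

definition determines :: "'a set \<Rightarrow> 'b \<Rightarrow> bool" where
  "determines F y \<longleftrightarrow> (\<forall>f\<in>Cp_carrier K. (\<forall>x\<in>F. f x = 0) \<longrightarrow> T f y = 0)"

lemma determinesD:
  "\<lbrakk>determines F y; f \<in> Cp_carrier K; \<And>x. x \<in> F \<Longrightarrow> f x = 0\<rbrakk> \<Longrightarrow> T f y = 0"
  by (simp add: determines_def)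

text \<open>Continuity at zero bounds \<open>T f y\<close> by 1 in absolute value for all
  \<open>f\<close> vanishing on some finite \<open>F\<close>. These functions are closed under
  scaling, so the value must be 0: otherwise it could be normalised to 1.\<close>

lemma ex_finite_determines:
  assumes y: "y \<in> topspace L"
  shows "\<exists>F. finite F \<and> F \<subseteq> topspace K \<and> determines F y"
proof -
  have "openin (Cp K) {f \<in> topspace (Cp K). T f y \<in> {-1<..<1}}"
    by (rule openin_continuous_map_preimage[OF continuous_map_T_eval[OF y]]) simp
  moreover have "(\<lambda>_. 0) \<in> {f \<in> topspace (Cp K). T f y \<in> {-1<..<1}}"
    by (simp add: Cp_zero T_zero)
  ultimately obtain F where F: "finite F" "F \<subseteq> topspace K"
    "\<And>f. \<lbrakk>f \<in> Cp_carrier K; \<And>x. x \<in> F \<Longrightarrow> f x = 0\<rbrakk> \<Longrightarrow> f \<in> {f \<in> topspace (Cp K). T f y \<in> {-1<..<1}}"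
    by (rule Cp_nbhd_zero) blast
  have "T f y = 0" if f: "f \<in> Cp_carrier K" "\<forall>x\<in>F. f x = 0" for f
  proof (rule ccontr)
    assume "T f y \<noteq> 0"
    moreover have "(\<lambda>x. 1 / T f y * f x) \<in> Cp_carrier K"
      using Cp_lincomb[OF f(1) f(1), of "1 / T f y" 0] by simp
    ultimately show False
      using F(3)[of "\<lambda>x. 1 / T f y * f x"] f by (simp add: T_scale[of f "1 / T f y", simplified])
  qed
  then show ?thesis using F(1,2) unfolding determines_def by blast
qed

definition support :: "'b \<Rightarrow> 'a set" where
  "support y = (SOME F. finite F \<and> F \<subseteq> topspace K \<and> determines F y \<and> (\<forall>F'\<subset>F. \<not> determines F' y))"

lemma support:
  assumes "y \<in> topspace L"
  shows "finite (support y)" "support y \<subseteq> topspace K" "determines (support y) y"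
    "\<And>F'. F' \<subset> support y \<Longrightarrow> \<not> determines F' y"
proof -
  define fd where "fd = (\<lambda>F. finite F \<and> F \<subseteq> topspace K \<and> determines F y)"
  obtain F0 where "fd F0"
    using ex_finite_determines[OF assms] by (auto simp: fd_def)
  \<comment> \<open>Least cardinality among finite determining sets implies minimality under
    inclusion.\<close>
  then obtain F where "fd F" and least: "\<And>F'. fd F' \<Longrightarrow> card F \<le> card F'"
    using ex_has_least_nat[of fd F0 card] by blast
  then have F: "finite F" "F \<subseteq> topspace K" "determines F y"
    by (auto simp: fd_def)
  have "\<not> determines F' y" if "F' \<subset> F" for F'
  proof
    assume "determines F' y"
    then have "fd F'"
      using F that finite_subset[of F' F] by (auto simp: fd_def)
    then show False using least[of F'] psubset_card_mono[OF F(1) that] by simp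
  qed
  then have "\<exists>F. finite F \<and> F \<subseteq> topspace K \<and> determines F y \<and> (\<forall>F'\<subset>F. \<not> determines F' y)"
    using F by blast
  from someI_ex[OF this, folded support_def]
  show "finite (support y)" "support y \<subseteq> topspace K" "determines (support y) y"
    "\<And>F'. F' \<subset> support y \<Longrightarrow> \<not> determines F' y" by auto
qed

text \<open>A function \<open>g\<close> vanishing outside \<open>U\<close> with \<open>T g y\<close>
  nonzero is a witness that persists: \<open>T g\<close> stays nonzero near \<open>y\<close>, and a
  support missing \<open>U\<close> would force the value 0.\<close>

lemma openin_support_meets:
  assumes U: "openin K U"
  shows "openin L {y \<in> topspace L. support y \<inter> U \<noteq> {}}"
proof (subst openin_subopen, clarify)
  fix y assume y: "y \<in> topspace L" and "support y \<inter> U \<noteq> {}"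
  then obtain x where x: "x \<in> support y" "x \<in> U" by blast
  define V where "V = U - (support y - {x})"
  have "openin K V"
    unfolding V_def
  proof (rule openin_diff[OF U closedin_Hausdorff_finite[OF Hausdorff]])
    show "support y - {x} \<subseteq> topspace K" "finite (support y - {x})"
      using support(1,2)[OF y] by auto
  qed
  then obtain h where h: "h \<in> Cp_carrier K" "h x = 1" "\<And>z. z \<notin> V \<Longrightarrow> h z = 0"
    using Cp_bump[OF compact Hausdorff] x by (metis DiffI Diff_iff V_def singletonI)
  have "\<not> determines (support y - {x}) y"
    using support(4)[OF y] x by blast
  then obtain f where f: "f \<in> Cp_carrier K" "\<And>z. z \<in> support y - {x} \<Longrightarrow> f z = 0" "T f y \<noteq> 0"
    unfolding determines_def by blast
  define g where "g = (\<lambda>z. f z * h z)"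
  have g: "g \<in> Cp_carrier K" "\<And>z. z \<notin> V \<Longrightarrow> g z = 0"
    using Cp_mult[OF f(1) h(1)] h(3) by (auto simp: g_def)
  \<comment> \<open>The difference of \<open>f\<close> and \<open>g\<close> vanishes on the support:
    at \<open>x\<close> because \<open>h x = 1\<close>, elsewhere because \<open>f\<close> does.
    Hence \<open>T g y = T f y\<close>.\<close>
  have "(\<lambda>z. 1 * f z + (-1) * g z) \<in> Cp_carrier K"
    by (rule Cp_lincomb[OF f(1) g(1)])
  moreover have "1 * f z + (-1) * g z = 0" if "z \<in> support y" for z
    using that f(2)[of z] h(2) by (cases "z = x") (auto simp: g_def)
  ultimately have "T (\<lambda>z. 1 * f z + (-1) * g z) y = 0"
    by (rule determinesD[OF support(3)[OF y]])
  then have gy: "T g y \<noteq> 0"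
    using lin[rule_format, OF f(1) g(1), of 1 "-1"] f(3) by simp
  have "openin L {y' \<in> topspace L. T g y' \<in> - {0}}"
    by (rule openin_continuous_map_preimage[OF continuous_map_T[OF g(1)]]) (simp add: open_Compl)
  moreover have "support y' \<inter> U \<noteq> {}" if y': "y' \<in> topspace L" "T g y' \<noteq> 0" for y'
  proof -
    obtain u where u: "u \<in> support y'" "g u \<noteq> 0"
      using determinesD[OF support(3)[OF y'(1)] g(1)] y'(2) by blast
    then have "u \<in> U" using g(2)[of u] by (auto simp: V_def)
    then show ?thesis using u(1) by blast
  qed
  ultimately show "\<exists>W. openin L W \<and> y \<in> W \<and> W \<subseteq> {y \<in> topspace L. support y \<inter> U \<noteq> {}}"
    using y gy by (intro exI[of _ "{y' \<in> topspace L. T g y' \<in> - {0}}"]) auto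
qed

text \<open>Surjectivity provides functions dual to any finite set of points of \<open>L\<close>.
  With more than \<open>card F\<close> points of support \<open>F\<close>, some nontrivial
  combination of these functions vanishes on \<open>F\<close>; evaluating its image under
  \<open>T\<close> at each point shows that all coefficients are 0.\<close>

lemma finite_support_fibre:
  assumes L: "compact_space L" "Hausdorff_space L" and surj: "T ` Cp_carrier K = Cp_carrier L"
  shows "finite {y \<in> topspace L. support y = F}"
proof (rule ccontr)
  assume "infinite {y \<in> topspace L. support y = F}"
  then obtain Y where Y: "Y \<subseteq> {y \<in> topspace L. support y = F}" "finite Y" "card Y = Suc (card F)"
    using infinite_arbitrarily_large[of "{y \<in> topspace L. support y = F}" "Suc (card F)"] by auto
  have "\<exists>f. f \<in> Cp_carrier K \<and> T f y = 1 \<and> (\<forall>y'\<in>Y - {y}. T f y' = 0)" if y: "y \<in> Y" for y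
  proof -
    have "openin L (topspace L - (Y - {y}))"
      using Y(1,2) by (intro openin_diff[OF openin_topspace] closedin_Hausdorff_finite[OF L(2)]) auto
    moreover have "y \<in> topspace L - (Y - {y})" using y Y(1) by auto
    ultimately obtain h where h: "h \<in> Cp_carrier L" "h y = 1"
      "\<And>z. z \<notin> topspace L - (Y - {y}) \<Longrightarrow> h z = 0"
      by (rule Cp_bump[OF L]) (rule that)
    have "h \<in> T ` Cp_carrier K" using h(1) surj by simp
    then obtain f where f: "f \<in> Cp_carrier K" "h = T f" by (rule imageE)
    have "T f y' = 0" if "y' \<in> Y - {y}" for y'
      using h(3)[of y'] that f(2) by simp
    then show ?thesis using h(2) f by blast
  qed
  then have "\<exists>f. \<forall>y\<in>Y. f y \<in> Cp_carrier K \<and> T (f y) y = 1 \<and> (\<forall>y'\<in>Y - {y}. T (f y) y' = 0)"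
    by (intro bchoice ballI)
  then obtain f where
    "\<forall>y\<in>Y. f y \<in> Cp_carrier K \<and> T (f y) y = 1 \<and> (\<forall>y'\<in>Y - {y}. T (f y) y' = 0)"
    by (rule exE)
  then have f: "\<And>y. y \<in> Y \<Longrightarrow> f y \<in> Cp_carrier K" "\<And>y. y \<in> Y \<Longrightarrow> T (f y) y = 1"
    "\<And>y y'. \<lbrakk>y \<in> Y; y' \<in> Y; y' \<noteq> y\<rbrakk> \<Longrightarrow> T (f y) y' = 0"
    by (auto dest: bspec)
  \<comment> \<open>\<open>Y\<close> is nonempty because of \<open>Suc\<close>, even if
    \<open>card F\<close> is 0, and any point of it has the finite set \<open>F\<close> as its
    support.\<close>
  obtain y0 where "y0 \<in> Y" using Y(3) by fastforce
  then have "finite F" using support(1) Y(1) by auto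
  then obtain c where c: "\<exists>y\<in>Y. c y \<noteq> 0" "\<forall>x\<in>F. (\<Sum>y\<in>Y. c y * f y x) = 0"
    using exists_nontrivial_relation[of F Y f] Y by auto
  have "c y = 0" if y: "y \<in> Y" for y
  proof -
    have det: "determines F y" using Y(1) y support(3) by auto
    note Tsum = T_sum[of Y f c, OF Y(2) f(1)]
    have "T (\<lambda>x. \<Sum>y'\<in>Y. c y' * f y' x) y = 0"
      by (rule determinesD[OF det conjunct1[OF Tsum]]) (use c(2) in auto)
    then have "(\<Sum>y'\<in>Y. c y' * T (f y') y) = 0"
      using conjunct2[OF Tsum] by simp
    moreover have "(\<Sum>y'\<in>Y. c y' * T (f y') y) = (\<Sum>y'\<in>Y. if y' = y then c y' else 0)"
      using f(2,3) y by (intro sum.cong) auto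
    ultimately show ?thesis using Y(2) y by simp
  qed
  then show False using c(1) by blast
qed

end

theorem theorem4p6:
  fixes K :: "'a topology" and L :: "'b topology"
    and T :: "('a \<Rightarrow> real) \<Rightarrow> ('b \<Rightarrow> real)"
  assumes "compact_space K" "Hausdorff_space K"
    and "compact_space L" "Hausdorff_space L"
    and "contains_cantor L"
    and "continuous_map (Cp K) (Cp L) T"
    and "\<forall>f\<in>Cp_carrier K. \<forall>g\<in>Cp_carrier K. \<forall>a b :: real.
           T (\<lambda>x. a * f x + b * g x) = (\<lambda>y. a * T f y + b * T g y)"
    and "T ` Cp_carrier K = Cp_carrier L"
  shows "contains_cantor K"
proof -
  interpret Cp_operator K L T
    using assms by unfold_locales auto
  obtain S where S: "S \<subseteq> topspace L" "cantor_space homeomorphic_space subtopology L S"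
    using assms(5) unfolding contains_cantor_def by (metis homeomorphic_space_sym)
  then obtain e where hom: "homeomorphic_map cantor_space (subtopology L S) e"
    unfolding homeomorphic_space by blast
  then have e: "continuous_map cantor_space L e" "inj e"
    using homeomorphic_imp_continuous_map[OF hom] homeomorphic_imp_injective_map[OF hom]
    by (simp_all add: continuous_map_in_subtopology)
  then have eL: "e z \<in> topspace L" for z
    using continuous_map_image_subset_topspace[OF e(1)] by auto
  \<comment> \<open>The criterion is applied to \<open>\<lambda>z. support (e z)\<close>: continuity
    of \<open>e\<close> pulls back lower semicontinuity, and injectivity keeps the fibres
    finite.\<close>
  show ?thesis
  proof (rule contains_cantor_if_lower_semicontinuous[OF Hausdorff])
    show "finite (support (e z))" "support (e z) \<subseteq> topspace K" for z
      using support(1,2) eL by auto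
    show "openin cantor_space {z. support (e z) \<inter> U \<noteq> {}}" if "openin K U" for U
      using openin_continuous_map_preimage[OF e(1) openin_support_meets[OF that]] eL by simp
    have "finite (e -` {y \<in> topspace L. support y = F})" for F
      by (intro finite_vimageI finite_support_fibre assms e)
    then show "countable {z. support (e z) = F}" for F
      using eL by (auto simp: vimage_def intro: countable_finite)
  qed
qed

end
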